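(* Let $n \ge 1$ and $k \ge 1$ be integers. Then $$S_{2k} = \left(\frac{S_2}{S_1}\right) \Lambda_k \begin{vmatrix} \binom{3}{2} & 0 & 0 & \cdots & 0 & 8S_1 \\ \binom{5}{2} & \binom{5}{4} & 0 & \cdots & 0 & (1+8S_1)^2 -1 \\ \binom{7}{2} & \binom{7}{4} & \binom{7}{6} & \cdots & 0 & (1+8S_1)^3 -1 \\ \vdots & \vdots & \vdots & \ddots & \vdots & \vdots \\ \binom{2k-1}{2} & \binom{2k-1}{4} & \binom{2k-1}{6} & \cdots & \binom{2k-1}{2k-2} & (1+8S_1)^{k-1}-1 \\ \binom{2k+1}{2} & \binom{2k+1}{4} & \binom{2k+1}{6} & \cdots & \binom{2k+1}{2k-2} & (1+8S_1)^{k} - 1 \end{vmatrix}, \qquad \Lambda_k = \frac{3\cdot (k+1)!}{(2k+2)!\, 2^{k}}.$$ That is, the determinant is that of the $k\times k$ matrix whose $(i,j)$ entry is $\binom{2i+1}{2j}$ for $1 \le i \le k$, $1 \le j \le k-1$ (which is $0$ when $j>i$), and whose $(i,k)$ entry is $(1+8S_1)^{i}-1$ for $1 \le i \le k$. This gives $S_{2k}$ as $S_2$ times a polynomial in $S_1$ of degree $k-1$ (with coefficients independent of $n$).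
   Context: For integers $m \ge 0$ and $n \ge 1$, $S_m = 1^m + 2^m + \cdots + n^m$ denotes the sum of the $m$th powers of the first $n$ positive integers (the dependence on $n$ is suppressed in the notation). *)

theory Defs
  imports "Jordan_Normal_Form.Determinant" "HOL-Computational_Algebra.Polynomial"
begin

definition S :: "nat \<Rightarrow> nat \<Rightarrow> rat" where
  "S m n = (\<Sum>j = 1..n. of_nat j ^ m)"

definition \<Lambda> :: "nat \<Rightarrow> rat" where
  "\<Lambda> k = 3 * fact (k + 1) / (fact (2 * k + 2) * 2 ^ k)"

text \<open>Matrices are indexed from 0, so the (i,j) entry in the usual numbering
  1 \<le> i, j \<le> k sits at position (i - 1, j - 1). In columns before the last, entries with
  j > i vanish because the binomial coefficient does.\<close>

definition power_sum_mat :: "nat \<Rightarrow> nat \<Rightarrow> rat mat" where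
  "power_sum_mat k n = mat k k (\<lambda>(i0, j0).
     let i = i0 + 1; j = j0 + 1 in
     if j < k then of_nat ((2 * i + 1) choose (2 * j)) else (1 + 8 * S 1 n) ^ i - 1)"

end

theory Submission
  imports Defs
begin

text \<open>
  Summing the odd part of the binomial expansion,
  \<open>(y + 1) ^ (2 * i + 1) - (y - 1) ^ (2 * i + 1) = 2 * (\<Sum>r\<le>i. (2 * i + 1 choose 2 * r) * y ^ (2 * r))\<close>,
  over \<open>y = 2, 4, ..., 2 * n\<close> telescopes the left-hand side.  Since \<open>(2 * n + 1)\<^sup>2 = 1 + 8 * S 1 n\<close>,
  what remains (lemma \<open>even_power_sum_system\<close>) is a linear system whose \<open>i\<close>-th equation has
  right-hand side \<open>(2 * n + 1) * ((1 + 8 * S 1 n) ^ i - 1)\<close> and whose unknowns are the numbers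
  \<open>2 ^ (2 * r + 1) * S (2 * r) n\<close>.  The coefficient matrix is lower triangular, with
  determinant \<open>3 * 5 * ... * (2 * k + 1)\<close>, and replacing its last column by the right-hand side
  gives the matrix of the theorem; so Cramer's rule yields the last unknown.  The remaining factor
  \<open>2 * n + 1\<close> is \<open>3 * S 2 n / S 1 n\<close>.

  The polynomial comes from the same system, solved from the top down: the quotient
  \<open>((1 + 8 * x) ^ k - 1) / x\<close> is a polynomial of degree \<open>k - 1\<close>, and all earlier unknowns
  contribute polynomials of smaller degree.
\<close>

section \<open>The linear system for the even power sums\<close>

lemma odd_power_central_difference:
  fixes y :: "'a :: comm_ring_1"
  shows "(y + 1) ^ (2 * i + 1) - (y - 1) ^ (2 * i + 1)
    = 2 * (\<Sum>r\<le>i. of_nat ((2 * i + 1) choose (2 * r)) * y ^ (2 * r))"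
proof -
  let ?N = "Suc (2 * i)"
  have minus: "y - 1 = y + (- 1)" by simp
  have "(y + 1) ^ ?N - (y - 1) ^ ?N
      = (\<Sum>s\<le>?N. of_nat (?N choose s) * y ^ s * (1 - (- 1) ^ (?N - s)))"
    unfolding minus binomial_ring sum_subtractf[symmetric]
    by (intro sum.cong) (simp_all add: algebra_simps)
  also have "\<dots> = (\<Sum>r\<le>i. 2 * (of_nat (?N choose (2 * r)) * y ^ (2 * r)))"
    unfolding sum.in_pairs_0
  proof (intro sum.cong refl)
    fix r assume "r \<in> {..i}"
    then have odd: "?N - 2 * r = Suc (2 * (i - r))" and even: "?N - Suc (2 * r) = 2 * (i - r)"
      by auto
    show "of_nat (?N choose (2 * r)) * y ^ (2 * r) * (1 - (- 1) ^ (?N - 2 * r))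
        + of_nat (?N choose Suc (2 * r)) * y ^ Suc (2 * r) * (1 - (- 1) ^ (?N - Suc (2 * r)))
        = 2 * (of_nat (?N choose (2 * r)) * y ^ (2 * r))"
      unfolding odd even by (simp add: algebra_simps)
  qed
  finally show ?thesis by (simp add: sum_distrib_left)
qed

lemma S_1_eq: "S 1 n = of_nat n * (of_nat n + 1) / 2"
  by (induction n) (simp_all add: S_def field_simps)

lemma S_2_eq: "S 2 n = of_nat n * (of_nat n + 1) * (2 * of_nat n + 1) / 6"
  by (induction n) (simp_all add: S_def field_simps power2_eq_square)

lemma square_eq_S_1: "(2 * of_nat n + 1)\<^sup>2 = 1 + 8 * S 1 n"
  unfolding S_1_eq by (simp add: power2_eq_square field_simps)

lemma S_1_nonzero: "S 1 n \<noteq> 0" if "n \<ge> 1"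
proof -
  have "of_nat n > (0 :: rat)" using that by simp
  then show ?thesis unfolding S_1_eq by simp
qed

lemma odd_eq_S_ratio: "2 * of_nat n + 1 = 3 * S 2 n / S 1 n" if "n \<ge> 1"
proof -
  have "3 * S 2 n = (2 * of_nat n + 1) * S 1 n"
    unfolding S_1_eq S_2_eq by (simp add: field_simps)
  then show ?thesis using S_1_nonzero[OF that] by (simp add: field_simps)
qed

lemma odd_power_telescope:
  "(2 * of_nat n + 1) ^ (2 * i + 1)
    = 1 + (\<Sum>r\<le>i. of_nat ((2 * i + 1) choose (2 * r)) * 2 ^ (2 * r + 1) * S (2 * r) n)"
proof (induction n)
  case 0
  then show ?case by (simp add: S_def)
next
  case (Suc n)
  define y :: rat where "y = 2 * of_nat (Suc n)"
  have step: "of_nat ((2 * i + 1) choose (2 * r)) * 2 ^ (2 * r + 1) * S (2 * r) (Suc n)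
      = of_nat ((2 * i + 1) choose (2 * r)) * 2 ^ (2 * r + 1) * S (2 * r) n
        + 2 * (of_nat ((2 * i + 1) choose (2 * r)) * y ^ (2 * r))" for r
    by (simp add: S_def y_def power_mult_distrib algebra_simps del: of_nat_Suc)
  have y: "2 * of_nat n + 1 = y - 1" "2 * of_nat (Suc n) + 1 = y + 1"
    by (simp_all add: y_def)
  show ?case
    using Suc odd_power_central_difference[of y i]
    unfolding step sum.distrib sum_distrib_left[symmetric] y by simp
qed

text \<open>Summing over all \<open>r < k\<close>, rather than only over \<open>r < i\<close>, adds vanishing binomial
  coefficients; in this form the equations for \<open>i = 1, ..., k\<close> are the rows of one square
  system.  The term \<open>2 * S 0 n = 2 * n\<close> and the constant \<open>1\<close> of the telescoped identity add up to
  \<open>2 * n + 1\<close>, which is what \<open>- 1\<close> in the last factor stands for.\<close>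

lemma even_power_sum_system:
  assumes "i \<le> k"
  shows "(\<Sum>r<k. of_nat ((2 * i + 1) choose (2 * r + 2)) * (2 ^ (2 * r + 3) * S (2 * r + 2) n))
    = (2 * of_nat n + 1) * ((1 + 8 * S 1 n) ^ i - 1)"
proof -
  let ?f = "\<lambda>r. of_nat ((2 * i + 1) choose (2 * r)) * 2 ^ (2 * r + 1) * S (2 * r) n"
  have "(\<Sum>r<k. of_nat ((2 * i + 1) choose (2 * r + 2)) * (2 ^ (2 * r + 3) * S (2 * r + 2) n))
      = (\<Sum>r<k. ?f (Suc r))"
    by (simp add: mult.assoc eval_nat_numeral)
  also have "\<dots> = (\<Sum>r<i. ?f (Suc r))"
    using assms by (intro sum.mono_neutral_right) (auto simp: binomial_eq_0)
  also have "\<dots> = (\<Sum>r\<le>i. ?f r) - ?f 0"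
    by (simp add: sum.atMost_shift)
  also have "\<dots> = (2 * of_nat n + 1) ^ (2 * i + 1) - (2 * of_nat n + 1)"
    unfolding odd_power_telescope[of n i] by (simp add: S_def)
  also have "\<dots> = (2 * of_nat n + 1) * ((1 + 8 * S 1 n) ^ i - 1)"
    unfolding square_eq_S_1[symmetric] power_mult[symmetric]
    by (simp add: algebra_simps)
  finally show ?thesis .
qed

section \<open>The determinant formula\<close>

definition binomial_mat :: "nat \<Rightarrow> rat mat" where
  "binomial_mat k = mat k k (\<lambda>(i, j). of_nat ((2 * i + 3) choose (2 * j + 2)))"

lemma prod_odd_numbers:
  "(\<Prod>i<k. of_nat (2 * i + 3)) * fact (k + 1) * 2 ^ (k + 1) = (fact (2 * k + 2) :: 'a :: field_char_0)"
proof (induction k)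
  case (Suc k)
  let ?P = "\<Prod>i<k. of_nat (2 * i + 3) :: 'a"
  have "(\<Prod>i<Suc k. of_nat (2 * i + 3)) * fact (Suc k + 1) * 2 ^ (Suc k + 1)
      = (?P * fact (k + 1) * 2 ^ (k + 1)) * (of_nat (2 * k + 3) * of_nat (2 * k + 4) :: 'a)"
    by (simp add: algebra_simps)
  also have "\<dots> = fact (2 * k + 2) * (of_nat (2 * k + 3) * of_nat (2 * k + 4))"
    unfolding Suc ..
  also have "\<dots> = fact (2 * Suc k + 2)"
    by (simp add: eval_nat_numeral algebra_simps)
  finally show ?case .
qed simp

lemma det_binomial_mat: "det (binomial_mat k) = (\<Prod>i<k. of_nat (2 * i + 3))"
proof -
  have diag: "(2 * i + 3) choose (2 * i + 2) = 2 * i + 3" for i :: nat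
    using binomial_Suc_n[of "2 * i + 2"] by (simp add: eval_nat_numeral)
  have "det (binomial_mat k) = prod_list (diag_mat (binomial_mat k))"
    by (rule det_lower_triangular[where n = k]) (auto simp: binomial_mat_def)
  also have "\<dots> = (\<Prod>i = 0..<k. binomial_mat k $$ (i, i))"
    by (simp add: prod_list_diag_prod binomial_mat_def)
  also have "\<dots> = (\<Prod>i<k. of_nat (2 * i + 3))"
    by (intro prod.cong) (simp_all only: lessThan_atLeast0 binomial_mat_def diag index_mat
        atLeastLessThan_iff split)
  finally show ?thesis .
qed

text \<open>The last column of \<open>power_sum_mat\<close> is the right-hand side of the system without its factor
  \<open>2 * n + 1\<close>, so Cramer's rule is applied to the unknowns divided by that factor.\<close>

lemma det_power_sum_mat:
  assumes "k \<ge> 1"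
  shows "det (power_sum_mat k n)
    = 2 ^ (2 * k + 1) * S (2 * k) n / (2 * of_nat n + 1) * (\<Prod>i<k. of_nat (2 * i + 3))"
proof -
  define c :: rat where "c = 2 * of_nat n + 1"
  define x where "x = vec k (\<lambda>r. 2 ^ (2 * r + 3) * S (2 * r + 2) n / c)"
  have "c > 0" unfolding c_def by (simp add: add_nonneg_pos)
  have x: "x \<in> carrier_vec k" and A: "binomial_mat k \<in> carrier_mat k k"
    by (simp_all add: x_def binomial_mat_def)
  have row: "(binomial_mat k *\<^sub>v x) $ i = (1 + 8 * S 1 n) ^ (i + 1) - 1" if "i < k" for i
  proof -
    have "(binomial_mat k *\<^sub>v x) $ i = (\<Sum>r<k. of_nat ((2 * (i + 1) + 1) choose (2 * r + 2))
        * (2 ^ (2 * r + 3) * S (2 * r + 2) n)) / c"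
      using that unfolding sum_divide_distrib
      by (auto simp: binomial_mat_def x_def scalar_prod_def lessThan_atLeast0 eval_nat_numeral
          intro!: sum.cong)
    also have "\<dots> = (1 + 8 * S 1 n) ^ (i + 1) - 1"
      using \<open>c > 0\<close> that even_power_sum_system[of "i + 1" k n] by (simp add: c_def)
    finally show ?thesis .
  qed
  have "power_sum_mat k n = replace_col (binomial_mat k) (binomial_mat k *\<^sub>v x) (k - 1)"
    using A row
    by (intro eq_matI)
      (auto simp: power_sum_mat_def replace_col_def binomial_mat_def eval_nat_numeral)
  then have "det (power_sum_mat k n) = x $ (k - 1) * det (binomial_mat k)"
    using cramer_lemma_mat[OF A x, of "k - 1"] assms by simp
  moreover have "x $ (k - 1) = 2 ^ (2 * k + 1) * S (2 * k) n / c"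
  proof -
    have "2 * (k - 1) + 3 = 2 * k + 1" "2 * (k - 1) + 2 = 2 * k" using assms by auto
    moreover have "x $ (k - 1) = 2 ^ (2 * (k - 1) + 3) * S (2 * (k - 1) + 2) n / c"
      using assms by (simp add: x_def)
    ultimately show ?thesis by (simp only:)
  qed
  ultimately show ?thesis by (simp add: det_binomial_mat c_def)
qed

lemma even_power_sum_det:
  assumes "k \<ge> 1" and "n \<ge> 1"
  shows "S (2 * k) n = (S 2 n / S 1 n) * \<Lambda> k * det (power_sum_mat k n)"
proof -
  define c :: rat where "c = 2 * of_nat n + 1"
  define P :: rat where "P = (\<Prod>i<k. of_nat (2 * i + 3))"
  have "c > 0" unfolding c_def by (simp add: add_nonneg_pos)
  have ratio: "S 2 n / S 1 n = c / 3"
    using odd_eq_S_ratio[OF assms(2)] by (simp add: c_def)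
  have "P \<noteq> 0" by (simp add: P_def)
  have Lam: "\<Lambda> k * P = 3 / 2 ^ (2 * k + 1)"
  proof -
    define F :: rat where "F = fact (k + 1)"
    have "F \<noteq> 0" unfolding F_def by (rule fact_nonzero)
    have pow: "(2 :: rat) ^ (2 * k + 1) = 2 * (2 ^ k * 2 ^ k)"
      by (simp add: power_even_eq power2_eq_square)
    have "\<Lambda> k = 3 * F / (P * F * 2 ^ (k + 1) * 2 ^ k)"
      unfolding \<Lambda>_def P_def F_def prod_odd_numbers ..
    then show ?thesis
      unfolding pow using \<open>P \<noteq> 0\<close> \<open>F \<noteq> 0\<close> by simp
  qed
  have "(S 2 n / S 1 n) * \<Lambda> k * det (power_sum_mat k n)
      = c / 3 * (\<Lambda> k * P) * (2 ^ (2 * k + 1) * S (2 * k) n / c)"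
    unfolding ratio det_power_sum_mat[OF assms(1)] c_def P_def by (simp only: mult_ac)
  also have "\<dots> = S (2 * k) n" unfolding Lam using \<open>c > 0\<close> by simp
  finally show ?thesis ..
qed

section \<open>Even power sums as polynomials in the first power sum\<close>

text \<open>The quotient is a geometric sum; its degree is easiest to read off from
  \<open>X * q + 1 = (1 + 8 * X) ^ k\<close>.\<close>

lemma power_quotient_poly:
  assumes "k \<ge> 1"
  obtains q :: "rat poly"
  where "degree q = k - 1" and "\<And>x. x * poly q x = (1 + 8 * x) ^ k - 1"
proof
  let ?b = "[:1, 8:] :: rat poly"
  let ?q = "smult 8 (\<Sum>i<k. ?b ^ i)"
  show eq: "x * poly ?q x = (1 + 8 * x) ^ k - 1" for x
    using power_diff_1_eq[of "1 + 8 * x" k] by (simp add: poly_sum algebra_simps)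
  have "poly (pCons 0 ?q + 1) = poly (?b ^ k)"
    using eq by (simp add: fun_eq_iff algebra_simps)
  then have "pCons 0 ?q + 1 = ?b ^ k"
    by (simp only: poly_eq_poly_eq_iff)
  moreover have "degree (pCons 0 ?q + 1) = degree (pCons 0 ?q)"
    by (cases "degree (pCons 0 ?q) = 0") (auto simp: degree_add_eq_left degree_pCons_eq_if
        split: if_splits)
  ultimately have "degree (pCons 0 ?q) = k"
    by (simp add: degree_power_eq)
  then show "degree ?q = k - 1"
    using assms by (simp add: degree_pCons_eq_if split: if_splits)
qed

text \<open>Dividing the \<open>k\<close>-th equation by \<open>S 2 n\<close> turns its right-hand side into three times the
  quotient above, because \<open>2 * n + 1 = 3 * S 2 n / S 1 n\<close>.  By induction the earlier unknowns are
  polynomials of degree at most \<open>k - 2\<close>, so they cannot cancel its leading term.\<close>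

lemma even_power_sum_poly:
  assumes "k \<ge> 1"
  shows "\<exists>p :: rat poly. degree p = k - 1 \<and> (\<forall>n\<ge>1. S (2 * k) n = S 2 n * poly p (S 1 n))"
  using assms
proof (induction k rule: less_induct)
  case (less k)
  then obtain m where k: "k = Suc m" by (cases k) auto
  have "\<forall>r. \<exists>p :: rat poly. r < m \<longrightarrow>
      degree p = r \<and> (\<forall>n\<ge>1. S (2 * r + 2) n = S 2 n * poly p (S 1 n))"
    using less.IH[of "Suc _"] k by simp
  then obtain P :: "nat \<Rightarrow> rat poly" where degP: "\<And>r. r < m \<Longrightarrow> degree (P r) = r"
    and P: "\<And>r n. r < m \<Longrightarrow> n \<ge> 1 \<Longrightarrow> S (2 * r + 2) n = S 2 n * poly (P r) (S 1 n)"
    by metis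
  have "m = k - 1" using k by simp
  then obtain q :: "rat poly" where degq: "degree q = m"
    and q: "\<And>x. x * poly q x = (1 + 8 * x) ^ k - 1"
    using power_quotient_poly[OF less.prems] by metis
  define a :: "nat \<Rightarrow> rat" where
    "a = (\<lambda>r. of_nat ((2 * k + 1) choose (2 * r + 2)) * 2 ^ (2 * r + 3))"
  define L where "L = (\<Sum>r<m. smult (a r) (P r))"
  define p where "p = smult (1 / a m) (smult 3 q - L)"
  have "a m \<noteq> 0" by (simp add: a_def k)
  have "degree p = m"
  proof (cases "m = 0")
    case True
    then show ?thesis using degq \<open>a m \<noteq> 0\<close> by (simp add: p_def L_def)
  next
    case False
    then have "degree L < m"
      unfolding L_def using degP by (intro degree_sum_less) auto
    then have "degree (smult 3 q - L) = m"
      using degq degree_add_eq_left[of "- L" "smult 3 q"] by simp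
    then show ?thesis using \<open>a m \<noteq> 0\<close> by (simp add: p_def)
  qed
  moreover have "S (2 * k) n = S 2 n * poly p (S 1 n)" if n: "n \<ge> 1" for n
  proof -
    let ?x = "S 1 n"
    have "(\<Sum>r<k. a r * S (2 * r + 2) n) = 3 * S 2 n / ?x * (?x * poly q ?x)"
      using even_power_sum_system[of k k n] odd_eq_S_ratio[OF n]
      by (simp add: a_def q mult.assoc)
    also have "\<dots> = S 2 n * poly (smult 3 q) ?x"
      using S_1_nonzero[OF n] by simp
    finally have "(\<Sum>r<m. a r * S (2 * r + 2) n) + a m * S (2 * k) n
        = S 2 n * poly (smult 3 q) ?x"
      by (simp add: k)
    moreover have "(\<Sum>r<m. a r * S (2 * r + 2) n) = S 2 n * poly L ?x"
      using P n by (auto simp: L_def poly_sum sum_distrib_left mult_ac intro!: sum.cong)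
    ultimately have "a m * S (2 * k) n = S 2 n * poly (smult 3 q - L) ?x"
      by (simp add: algebra_simps)
    then show ?thesis using \<open>a m \<noteq> 0\<close> by (simp add: p_def field_simps)
  qed
  ultimately show ?case using k by auto
qed

theorem mainTheorem4:
  fixes k :: nat
  assumes "k \<ge> 1"
  shows "(\<forall>n\<ge>1. S (2 * k) n = (S 2 n / S 1 n) * \<Lambda> k * det (power_sum_mat k n)) \<and>
    (\<exists>p :: rat poly. degree p = k - 1 \<and>
       (\<forall>n\<ge>1. S (2 * k) n = S 2 n * poly p (S 1 n)))"
  using even_power_sum_det[OF assms] even_power_sum_poly[OF assms] by blast

end
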